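(* There are no positive integers $a$ and $b$ such that $\binom{an+bn}{an}\equiv 0\pmod{3n-1}$ for all integers $n\ge 1$. *)

theory Defs
  imports "HOL-Number_Theory.Number_Theory"
begin

end

theory Submission
  imports Defs
begin

text \<open>
  Write \<open>s = a + b\<close>. For a prime \<open>p\<close> not dividing \<open>s\<close> and \<open>1 \<le> h \<le> p\<close>, choose \<open>K > 0\<close> with
  \<open>s\<close> dividing \<open>p ^ K - 1\<close> and let \<open>s n = h (p ^ K - 1)\<close>. In base \<open>p\<close> the digits of \<open>s n\<close> are
  \<open>h - 1, p - 1, \<dots>, p - 1, p - h\<close>, so by Lucas the binomial coefficient is prime to \<open>p\<close> as soon as
  \<open>a n mod p \<le> p - h\<close>, while \<open>p\<close> divides \<open>3 n - 1\<close> iff it divides \<open>3 h + s\<close>.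

  If 3 does not divide \<open>s\<close>, take \<open>h = 1\<close> and \<open>p\<close> dividing \<open>s + 3\<close>. If 3 divides \<open>a\<close> and \<open>b\<close>, take
  \<open>p > s\<close> and \<open>h = p - s / 3\<close>; then \<open>a n\<close> is congruent to \<open>a / 3\<close>. Otherwise \<open>a \<noteq> b\<close>, so up to
  symmetry some prime \<open>p\<close> divides \<open>a\<close> to a higher power than \<open>b\<close>; after cancelling the common power
  of \<open>p\<close>, which does not affect divisibility of the binomial coefficient by \<open>p\<close>, the last digit of
  \<open>a n\<close> is 0 and any \<open>h\<close> is good.
\<close>

text \<open>Modulo \<open>p\<close>, (1 + X)^(p + m) is (1 + X^p) (1 + X)^m; on coefficients, only i
  = 0 and i = p survive in Vandermonde's sum.\<close>

lemma prime_add_choose_cong: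
  fixes p :: nat
  assumes "prime p"
  shows "[(p + m) choose k = (m choose k) + (if p \<le> k then m choose (k - p) else 0)] (mod p)"
proof -
  define f where "f i = (p choose i) * (m choose (k - i))" for i
  have dvd: "p dvd f i" if "i \<noteq> 0" "i \<noteq> p" for i
  proof (cases "i < p")
    case True
    then show ?thesis
      using dvd_choose_prime[of i p] assms that by (simp add: f_def)
  qed (use that in \<open>simp add: f_def binomial_eq_0\<close>)
  have "p > 0" using assms prime_gt_0_nat by blast
  have "(p + m) choose k = (\<Sum>i\<le>k. f i)"
    unfolding f_def by (rule vandermonde[symmetric])
  also have "\<dots> = (\<Sum>i\<in>{..k} - {0, p}. f i) + (\<Sum>i\<in>{..k} \<inter> {0, p}. f i)"
    by (subst sum.Int_Diff[of _ _ "{0, p}"]) (auto simp: add.commute)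
  also have "[\<dots> = 0 + (\<Sum>i\<in>{..k} \<inter> {0, p}. f i)] (mod p)"
    by (intro cong_add cong_refl) (auto simp: cong_0_iff intro!: dvd_sum dvd)
  also have "{..k} \<inter> {0, p} = (if p \<le> k then {0, p} else {0})"
    by auto
  also have "0 + (\<Sum>i\<in>\<dots>. f i) = (m choose k) + (if p \<le> k then m choose (k - p) else 0)"
    using \<open>p > 0\<close> by (simp add: f_def)
  finally show ?thesis .
qed

text \<open>Peels off the last base-\<open>p\<close> digits. Raising \<open>m\<close> by one adds
  \<open>p\<close> to the top, and the two resulting terms recombine by Pascal's rule.\<close>

lemma Lucas_step:
  fixes p :: nat
  assumes p: "prime p" and i: "i < p" and j: "j < p"
  shows "[(p * m + i) choose (p * k + j) = (m choose k) * (i choose j)] (mod p)"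
proof (induction m arbitrary: k)
  case 0
  have "i choose (p * k + j) = 0" if "k > 0"
    using i that by (intro binomial_eq_0) (cases k; simp)
  then show ?case by (cases "k = 0") (auto simp: binomial_eq_0)
next
  case (Suc m)
  have step: "[(p * Suc m + i) choose (p * k + j) = ((p * m + i) choose (p * k + j))
      + (if p \<le> p * k + j then (p * m + i) choose (p * k + j - p) else 0)] (mod p)"
    using prime_add_choose_cong[OF p, of "p * m + i" "p * k + j"] by (simp add: add_ac)
  show ?case
  proof (cases k)
    case 0
    with step Suc.IH[of 0] j show ?thesis by (auto intro: cong_trans)
  next
    case (Suc l)
    have "[((p * m + i) choose (p * k + j)) + ((p * m + i) choose (p * l + j))
        = (m choose k) * (i choose j) + (m choose l) * (i choose j)] (mod p)"
      by (intro cong_add Suc.IH)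
    with step Suc show ?thesis
      by (auto simp: algebra_simps intro: cong_trans)
  qed
qed

text \<open>Each factor \<open>p\<close> appends a digit 0 to both numbers, contributing only
  \<open>0 choose 0 = 1\<close> in Lucas.\<close>

lemma prime_dvd_choose_mult_iff:
  fixes p :: nat
  assumes "prime p"
  shows "p dvd ((p ^ w * m) choose (p ^ w * k)) \<longleftrightarrow> p dvd (m choose k)"
proof (induction w)
  case (Suc w)
  have "[(p * (p ^ w * m) + 0) choose (p * (p ^ w * k) + 0)
      = ((p ^ w * m) choose (p ^ w * k)) * (0 choose 0)] (mod p)"
    using assms prime_gt_0_nat by (intro Lucas_step) auto
  then show ?case
    using Suc.IH by (simp add: cong_dvd_iff mult.assoc)
qed auto

lemma prime_not_dvd_choose_small:
  fixes p :: nat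
  assumes "prime p" "i < p" "j \<le> i"
  shows "\<not> p dvd (i choose j)"
proof
  assume "p dvd (i choose j)"
  then have "p dvd fact i"
    using binomial_fact_lemma[OF \<open>j \<le> i\<close>] by (metis dvd_mult)
  then show False
    using assms by (simp add: prime_dvd_fact_iff)
qed

lemma prime_not_dvd_choose_Lucas:
  fixes p :: nat
  assumes "prime p" "i < p" "y mod p \<le> i" "\<not> p dvd (m choose (y div p))"
  shows "\<not> p dvd ((p * m + i) choose y)"
proof -
  have "[(p * m + i) choose (p * (y div p) + y mod p)
      = (m choose (y div p)) * (i choose (y mod p))] (mod p)"
    using assms prime_gt_0_nat by (intro Lucas_step) auto
  moreover have "\<not> p dvd (m choose (y div p)) * (i choose (y mod p))"
    using assms prime_not_dvd_choose_small by (simp add: prime_dvd_mult_iff)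
  ultimately show ?thesis by (simp add: cong_dvd_iff)
qed

text \<open>Below its leading part h - 1 the top number has only digits p - 1, which no digit of
  \<open>y\<close> exceeds; the bound on \<open>y\<close> keeps its leading part at most h -
  1.\<close>

lemma prime_not_dvd_choose_mult_power_minus_1:
  fixes p :: nat
  assumes p: "prime p" and h: "0 < h" "h \<le> p" and "y < h * p ^ K"
  shows "\<not> p dvd ((h * p ^ K - 1) choose y)"
  using \<open>y < h * p ^ K\<close>
proof (induction K arbitrary: y)
  case 0
  then show ?case using prime_not_dvd_choose_small[OF p, of "h - 1" y] h by simp
next
  case (Suc K)
  have p0: "p > 0" using p prime_gt_0_nat by blast
  have "h * p ^ Suc K - 1 = p * (h * p ^ K - 1) + (p - 1)"
  proof -
    obtain q where "h * p ^ K = Suc q"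
      using h p0 by (metis gr0_implies_Suc nat_0_less_mult_iff zero_less_power)
    then have "h * p ^ Suc K = p * Suc q" by (metis mult.left_commute power_Suc)
    then show ?thesis using p0 \<open>h * p ^ K = Suc q\<close> by simp
  qed
  moreover have "y div p < h * p ^ K"
    using Suc.prems p0 by (simp add: less_mult_imp_div_less algebra_simps)
  ultimately show ?case
    using prime_not_dvd_choose_Lucas[OF p, of "p - 1" y "h * p ^ K - 1"] Suc.IH p0
    by (simp add: Suc_le_eq less_Suc_eq_le[symmetric])
qed

text \<open>\<open>digit\<close> ranges over all inverses of 3 modulo \<open>p\<close> because
  \<open>n\<close> is only constructed inside the proof.\<close>

lemma exists_choose_not_dvd:
  fixes a b h p :: nat
  assumes p: "prime p" and ab: "\<not> p dvd a + b" and h: "0 < h" "h \<le> p"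
    and dvd: "p dvd 3 * h + (a + b)"
    and digit: "\<And>n. [3 * n = 1] (mod p) \<Longrightarrow> (a * n) mod p \<le> p - h"
  shows "\<exists>n\<ge>1. p dvd 3 * n - 1 \<and> \<not> p dvd ((a + b) * n choose (a * n))"
proof -
  have p0: "p > 1" using p prime_gt_1_nat by blast
  define s where "s = a + b"
  have s0: "s > 0" using ab by (cases s) (auto simp: s_def)
  have "coprime p s" using p ab by (simp add: s_def prime_imp_coprime)
  \<comment> \<open>Writing Euler's exponent as \<open>Suc K\<close> lets one factor
    \<open>p\<close> be split off later to expose the last digit.\<close>
  obtain K where K: "totient s = Suc K" using s0 by (metis gr0_implies_Suc totient_0_iff neq0_conv)
  have "[p ^ Suc K = 1] (mod s)"
    using euler_theorem[OF \<open>coprime p s\<close>] K by simp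
  then have "s dvd p ^ Suc K - 1"
    by (rule cong_to_1_nat)
  then have "s dvd h * (p ^ Suc K - 1)" by (rule dvd_mult)
  then obtain n where n: "h * (p ^ Suc K - 1) = s * n" ..
  have "p ^ Suc K > 1" using p0 by (rule one_less_power) simp
  then have "s * n > 0" using h by (simp flip: n del: power_Suc)
  then have n0: "n \<ge> 1" by simp
  have sn: "s * n + h = h * p ^ Suc K"
    using \<open>p ^ Suc K > 1\<close> by (simp flip: n add: diff_mult_distrib2 del: power_Suc)
  have "s * (3 * n - 1) + (3 * h + s) = 3 * (h * p ^ Suc K)"
    using n0 by (cases n) (simp_all flip: sn add: algebra_simps del: power_Suc)
  then have "p dvd s * (3 * n - 1) + (3 * h + s)" by simp
  then have "p dvd s * (3 * n - 1)"
    using dvd by (simp add: s_def dvd_add_left_iff)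
  then have 1: "p dvd 3 * n - 1"
    using p ab by (simp add: s_def prime_dvd_mult_iff)
  then have "[3 * n = 1] (mod p)"
    using n0 by (metis cong_altdef_nat le_trans mult_le_mono1 mult_1 one_le_numeral)
  then have d: "(a * n) mod p \<le> p - h" by (rule digit)
  have "s * n = p * (h * p ^ K - 1) + (p - h)"
  proof -
    obtain q where q: "h * p ^ K = Suc q"
      using h p0 by (metis gr0_implies_Suc nat_0_less_mult_iff zero_less_power less_trans zero_less_one)
    then have "h * p ^ Suc K = p * Suc q" by (metis mult.left_commute power_Suc)
    then show ?thesis using sn h q by simp
  qed
  moreover have "\<not> p dvd ((h * p ^ K - 1) choose (a * n div p))"
  proof (rule prime_not_dvd_choose_mult_power_minus_1[OF p h])
    have "a * n < h * p ^ Suc K"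
      using sn h by (simp add: s_def algebra_simps flip: sn)
    then show "a * n div p < h * p ^ K"
      by (simp add: less_mult_imp_div_less algebra_simps)
  qed
  ultimately have "\<not> p dvd (s * n choose (a * n))"
    using prime_not_dvd_choose_Lucas[OF p, of "p - h" "a * n"] d h p0 by simp
  with 1 n0 show ?thesis by (auto simp: s_def)
qed

lemma exists_choose_not_dvd_if_not_dvd:
  fixes a b :: nat
  assumes "a > 0" "b > 0" "\<not> 3 dvd a" "\<not> a dvd b"
  shows "\<exists>p n. n \<ge> 1 \<and> p dvd 3 * n - 1 \<and> \<not> p dvd ((a + b) * n choose (a * n))"
proof -
  define g where "g = gcd a b"
  obtain a' b' where a': "a = g * a'" and b': "b = g * b'" and cop: "coprime a' b'"
    using gcd_coprime_exists[of a b] assms unfolding g_def by (metis gcd_eq_0_iff less_irrefl mult.commute)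
  \<comment> \<open>If a' were 1, then a = g would divide \<open>b\<close>.\<close>
  have "a' \<noteq> 1" using assms a' b' by auto
  then obtain p where p: "prime p" "p dvd a'" using prime_factor_nat by blast
  have "g \<noteq> 0" using a' assms by auto
  obtain g' where g': "g = p ^ multiplicity p g * g'" "\<not> p dvd g'"
    using multiplicity_decompose'[of g p] \<open>g \<noteq> 0\<close> p
    by (metis not_prime_unit)
  define w where "w = multiplicity p g"
  \<comment> \<open>Cancelling the power of \<open>p\<close> in \<open>g\<close> leaves g' a',
    divisible by \<open>p\<close>, and g' b', not divisible by \<open>p\<close>.\<close>
  have "\<not> p dvd b'" using cop p by (metis coprime_common_divisor not_prime_unit)
  then have ns: "\<not> p dvd g' * a' + g' * b'"
    using p g' by (simp add: prime_dvd_mult_iff dvd_add_right_iff)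
  have "p \<noteq> 3" using assms a' p by auto
  then have "coprime 3 p" using p by (simp add: primes_coprime)
  then obtain x where x: "[3 * x = 1] (mod p)" using cong_solve_coprime_nat by auto
  have p0: "p > 0" using p prime_gt_0_nat by blast
  define s where "s = g' * a' + g' * b'"
  \<comment> \<open>As \<open>x\<close> inverts 3, \<open>h\<close> represents -s/3 modulo
    \<open>p\<close>, taken in the range 1 to p with p in place of 0.\<close>
  define h where "h = p - (s * x) mod p"
  have h: "0 < h" "h \<le> p" using p0 by (auto simp: h_def)
  have "[3 * h + s = 3 * h + s * (3 * x)] (mod p)"
    using cong_scalar_left[OF x, of s] by (intro cong_add cong_refl) (simp add: cong_sym_eq)
  also have "3 * h + s * (3 * x) = 3 * (h + s * x)" by (simp add: algebra_simps)
  also have "[3 * (h + s * x) = 3 * (h + (s * x) mod p)] (mod p)"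
    by (intro cong_mult cong_add cong_refl) (simp add: cong_def)
  also have "h + (s * x) mod p = p" using p0 by (simp add: h_def less_imp_le)
  also have "[3 * p = 0] (mod p)" by (simp add: cong_0_iff)
  finally have "p dvd 3 * h + s" by (simp add: cong_0_iff)
  moreover have "(g' * a' * n) mod p \<le> p - h" for n
    using p by (auto simp: mod_eq_0_iff_dvd)
  ultimately obtain n where n: "n \<ge> 1" "p dvd 3 * n - 1"
    "\<not> p dvd ((g' * a' + g' * b') * n choose (g' * a' * n))"
    using exists_choose_not_dvd[OF p(1) ns h] by (auto simp: s_def)
  have ga: "p ^ w * (g' * a' * n) = a * n"
    using a' g'(1) unfolding w_def by (metis mult.assoc)
  have gb: "p ^ w * (g' * b' * n) = b * n"
    using b' g'(1) unfolding w_def by (metis mult.assoc)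
  have "\<not> p dvd (p ^ w * ((g' * a' + g' * b') * n) choose (p ^ w * (g' * a' * n)))"
    using n prime_dvd_choose_mult_iff[OF p(1)] by blast
  also have "p ^ w * ((g' * a' + g' * b') * n) = (a + b) * n"
    unfolding distrib_right distrib_left ga gb ..
  finally show ?thesis using n ga by auto
qed

lemma exists_choose_not_dvd_3n_minus_1:
  fixes a b :: nat
  assumes ab: "a > 0" "b > 0"
  shows "\<exists>p n. n \<ge> 1 \<and> p dvd 3 * n - 1 \<and> \<not> p dvd ((a + b) * n choose (a * n))"
proof -
  consider "\<not> 3 dvd a + b" | "3 dvd a" "3 dvd b" | "3 dvd a + b" "\<not> 3 dvd a" "\<not> 3 dvd b"
    by (metis dvd_add_left_iff dvd_add_right_iff)
  then show ?thesis
  proof cases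
    case 1
    obtain p where p: "prime p" "p dvd 3 + (a + b)"
      using prime_factor_nat[of "3 + (a + b)"] by auto
    have "\<not> p dvd a + b"
    proof
      assume "p dvd a + b"
      then have "p dvd 3" using p by (simp add: dvd_add_left_iff)
      then have "p = 3" using p by (simp add: primes_dvd_imp_eq)
      with 1 \<open>p dvd a + b\<close> show False by simp
    qed
    moreover have "p > 0" using p prime_gt_0_nat by blast
    \<comment> \<open>For h = 1 every residue meets the digit bound.\<close>
    moreover have "(a * n) mod p \<le> p - 1" for n
      using \<open>p > 0\<close> by (metis Suc_pred' less_Suc_eq_le mod_less_divisor)
    ultimately show ?thesis
      using exists_choose_not_dvd[of p a b 1] p by auto
  next
    case 2
    then obtain a' b' where a': "a = 3 * a'" and b': "b = 3 * b'" by (auto elim!: dvdE)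
    obtain p where p: "prime p" "p > a + b" using bigger_prime by blast
    have "\<not> p dvd a + b" using p ab by (auto dest: dvd_imp_le)
    \<comment> \<open>The bound is a' + b', while a n = a' (3 n) is congruent to a'.\<close>
    moreover have "(a * n) mod p \<le> p - (p - (a' + b'))" if "[3 * n = 1] (mod p)" for n
    proof -
      have "[a' * (3 * n) = a' * 1] (mod p)" using that by (rule cong_scalar_left)
      then have "(a * n) mod p = a' mod p" by (simp add: a' cong_def mult_ac)
      also have "\<dots> \<le> a'" by simp
      finally show ?thesis using p a' b' by simp
    qed
    moreover have "3 * (p - (a' + b')) + (a + b) = 3 * p"
      using p a' b' by simp
    ultimately show ?thesis
      using exists_choose_not_dvd[of p a b "p - (a' + b')"] p a' b' by auto
  next
    case 3
    \<comment> \<open>Once they differ, one of the two does not divide the other and can take the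
      role of \<open>a\<close> in the preceding lemma.\<close>
    have "a \<noteq> b"
    proof
      assume "a = b"
      with 3 have "3 dvd 2 * a" by (simp add: mult_2)
      with 3 show False by presburger
    qed
    then consider "\<not> a dvd b" | "\<not> b dvd a" using dvd_antisym by blast
    then show ?thesis
    proof cases
      case 1
      then show ?thesis using exists_choose_not_dvd_if_not_dvd 3 ab by blast
    next
      case 2
      have "(b + a) * n choose (b * n) = (a + b) * n choose (a * n)" for n
        using binomial_symmetric[of "a * n" "(a + b) * n"] by (simp add: algebra_simps)
      then show ?thesis
        using exists_choose_not_dvd_if_not_dvd[of b a] 3 2 ab by simp
    qed
  qed
qed

theorem theorem2p4:
  shows "\<not> (\<exists>a b :: nat. a > 0 \<and> b > 0 \<and>
    (\<forall>n::nat. n \<ge> 1 \<longrightarrow> [(a * n + b * n) choose (a * n) = 0] (mod (3 * n - 1))))"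
proof
  assume "\<exists>a b :: nat. a > 0 \<and> b > 0 \<and>
    (\<forall>n::nat. n \<ge> 1 \<longrightarrow> [(a * n + b * n) choose (a * n) = 0] (mod (3 * n - 1)))"
  then obtain a b :: nat where ab: "a > 0" "b > 0"
    and *: "\<And>n. n \<ge> 1 \<Longrightarrow> 3 * n - 1 dvd ((a + b) * n choose (a * n))"
    by (auto simp: cong_0_iff distrib_right)
  from exists_choose_not_dvd_3n_minus_1[OF ab] * show False
    by (meson dvd_trans)
qed

end
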